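(* Let $(\Phi,\Psi)$ be a private key encryption scheme with message space $\mathcal{M}$, finite key space $\mathcal{K}$ and code space $\mathcal{C}$, whose codewords have $m$ components, and which satisfies both the $\epsilon$-security condition $$\max_{\mathbf{M}\in\mathcal{M},\,\mathbf{C}\in\mathcal{C}} \mathbb{P}[\Psi(\mathbf{C},K)=\mathbf{M}]\le \epsilon$$ (for a given $\epsilon$) and the known-plaintext condition that, for every $j$, every $\mathbf{M}$ and every $\mathbf{C}_{-j}$, $$\mathbb{P}[\Phi(\mathbf{M};K)=\mathbf{C}\mid \mathbf{M},\mathbf{C}_{-j}]\le \tfrac12 \quad\text{for any value of } C_j$$ (the conditional probability that the $j$-th code component equals any given value, given the message and all other code components, is at most $1/2$). Then $$|\mathcal{K}| \geq 2^m .$$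
   Context: Messages are vectors $\mathbf{M}=(M_1,\dots,M_m)\in\mathcal{M}$ drawn uniformly at random. The private key $K$ is drawn uniformly at random from $\mathcal{K}$, independently of the message. A private key encryption scheme is a pair of functions $\Phi:\mathcal{M}\times\mathcal{K}\to\mathcal{C}$, $\Psi:\mathcal{C}\times\mathcal{K}\to\mathcal{M}$ such that for any $\mathbf{M}\in\mathcal{M}$, $\Phi(\mathbf{M};K)=\mathbf{C}$ is such that $\Psi(\mathbf{C},K)=\mathbf{M}$. Codewords are vectors $\mathbf{C}=(C_1,\dots,C_m)$ of the same length $m$ as the message, over an appropriate alphabet; write $\mathbf{C}_{-j}=(C_1,\dots,C_{j-1},C_{j+1},\dots,C_m)$. *)

theory Defs
  imports "HOL-Probability.Probability"
begin

text \<open>Vectors with \<open>m\<close> components are lists of length \<open>m\<close>, with positions counted from \<open>0\<close>.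
  The message and key spaces are finite and nonempty, as their uniform distributions require.\<close>

locale private_key_scheme =
  fixes m :: nat
    and Msgs :: "'a list set" and Keys :: "'k set" and Codes :: "'c list set"
    and \<Phi> :: "'a list \<Rightarrow> 'k \<Rightarrow> 'c list"
    and \<Psi> :: "'c list \<Rightarrow> 'k \<Rightarrow> 'a list"
  assumes finite_Msgs: "finite Msgs" and Msgs_nonempty: "Msgs \<noteq> {}"
    and finite_Keys: "finite Keys" and Keys_nonempty: "Keys \<noteq> {}"
    and length_Msgs: "M \<in> Msgs \<Longrightarrow> length M = m"
    and length_Codes: "C \<in> Codes \<Longrightarrow> length C = m"
    and enc_closed: "M \<in> Msgs \<Longrightarrow> k \<in> Keys \<Longrightarrow> \<Phi> M k \<in> Codes"
    and dec_closed: "C \<in> Codes \<Longrightarrow> k \<in> Keys \<Longrightarrow> \<Psi> C k \<in> Msgs"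
    and correct: "M \<in> Msgs \<Longrightarrow> k \<in> Keys \<Longrightarrow> \<Psi> (\<Phi> M k) k = M"

definition msg_key :: "'a list set \<Rightarrow> 'k set \<Rightarrow> ('a list \<times> 'k) pmf" where
  "msg_key Msgs Keys = pair_pmf (pmf_of_set Msgs) (pmf_of_set Keys)"

definition omit_nth :: "nat \<Rightarrow> 'b list \<Rightarrow> 'b list" where
  "omit_nth j xs = take j xs @ drop (Suc j) xs"

text \<open>\<open>Codes\<close> may be infinite, but for finite \<open>Keys\<close> the probabilities below take only finitely
  many values, so that \<open>Max\<close> is a genuine maximum; see \<open>eps_secure_iff\<close>.\<close>

definition eps_secure ::
  "'a list set \<Rightarrow> 'k set \<Rightarrow> 'c list set \<Rightarrow> ('c list \<Rightarrow> 'k \<Rightarrow> 'a list) \<Rightarrow> real \<Rightarrow> bool" where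
  "eps_secure Msgs Keys Codes \<Psi> \<epsilon> \<longleftrightarrow>
     Max {\<P>(k in measure_pmf (pmf_of_set Keys). \<Psi> C k = M) | M C. M \<in> Msgs \<and> C \<in> Codes} \<le> \<epsilon>"

text \<open>When the conditioning event has probability \<open>0\<close>, the conditional probability is \<open>0\<close> by
  division by zero and the inequality imposes nothing.\<close>

definition known_plaintext_secure ::
  "nat \<Rightarrow> 'a list set \<Rightarrow> 'k set \<Rightarrow> ('a list \<Rightarrow> 'k \<Rightarrow> 'c list) \<Rightarrow> bool" where
  "known_plaintext_secure m Msgs Keys \<Phi> \<longleftrightarrow>
     (\<forall>j<m. \<forall>M\<in>Msgs. \<forall>C. length C = m \<longrightarrow>
        \<P>(\<omega> in measure_pmf (msg_key Msgs Keys).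
            \<Phi> (fst \<omega>) (snd \<omega>) = C \<bar>
            fst \<omega> = M \<and> omit_nth j (\<Phi> (fst \<omega>) (snd \<omega>)) = omit_nth j C) \<le> 1 / 2)"

lemma (in private_key_scheme) eps_secure_iff:
  "eps_secure Msgs Keys Codes \<Psi> \<epsilon> \<longleftrightarrow>
     (\<forall>M\<in>Msgs. \<forall>C\<in>Codes. \<P>(k in measure_pmf (pmf_of_set Keys). \<Psi> C k = M) \<le> \<epsilon>)"
proof -
  let ?S = "{\<P>(k in measure_pmf (pmf_of_set Keys). \<Psi> C k = M) | M C. M \<in> Msgs \<and> C \<in> Codes}"
  have "?S \<subseteq> (\<lambda>A. real (card A) / real (card Keys)) ` Pow Keys"
  proof
    fix x assume "x \<in> ?S"
    then obtain M C where "x = \<P>(k in measure_pmf (pmf_of_set Keys). \<Psi> C k = M)" by blast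
    then have "x = real (card (Keys \<inter> {k. \<Psi> C k = M})) / real (card Keys)"
      using measure_pmf_of_set[OF Keys_nonempty finite_Keys, of "{k. \<Psi> C k = M}"] by simp
    then show "x \<in> (\<lambda>A. real (card A) / real (card Keys)) ` Pow Keys" by blast
  qed
  then have fin: "finite ?S"
    by (rule finite_subset) (simp add: finite_Keys)
  obtain M k where "M \<in> Msgs" "k \<in> Keys"
    using Msgs_nonempty Keys_nonempty by blast
  then have ne: "?S \<noteq> {}"
    using enc_closed by blast
  show ?thesis
    unfolding eps_secure_def Max_le_iff[OF fin ne] by blast
qed

end

theory Submission
  imports Defs
begin

text \<open>Fix a message and consider the finite set \<open>S\<close> of its encryptions. If some \<open>C \<in> S\<close> were
  determined within \<open>S\<close> by its components other than \<open>j\<close>, the conditional probability of \<open>C\<close> given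
  these would be \<open>1\<close>. So every element of \<open>S\<close> has a neighbour in \<open>S\<close> in each of the \<open>m\<close> coordinate
  directions, which forces \<open>2 ^ m \<le> card S\<close> by induction on \<open>m\<close>: two elements that differ only in
  the first component give two disjoint slices of \<open>S\<close> with the same property in dimension \<open>m - 1\<close>.\<close>

lemma omit_nth_0_Cons [simp]: "omit_nth 0 (x # xs) = xs"
  by (simp add: omit_nth_def)

lemma omit_nth_Suc_Cons [simp]: "omit_nth (Suc j) (x # xs) = x # omit_nth j xs"
  by (simp add: omit_nth_def)

text \<open>The combinatorial core, free of probability. The bound is sharp: the set of all words of
  length \<open>m\<close> over two letters attains it.\<close>

lemma card_ge_power_if_neighbours:
  assumes "finite S" "S \<noteq> {}" "\<And>xs. xs \<in> S \<Longrightarrow> length xs = m"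
    and "\<And>xs j. xs \<in> S \<Longrightarrow> j < m \<Longrightarrow> \<exists>ys\<in>S. ys \<noteq> xs \<and> omit_nth j ys = omit_nth j xs"
  shows "2 ^ m \<le> card S"
  using assms
proof (induction m arbitrary: S)
  case 0
  then show ?case by (simp add: Suc_leI card_gt_0_iff)
next
  case (Suc m)
  define slice where "slice a = {xs. a # xs \<in> S}" for a
  have fin: "finite (slice a)" for a
    using finite_vimageI[OF Suc.prems(1), of "Cons a"] by (simp add: slice_def vimage_def)
  have slice_ge: "2 ^ m \<le> card (slice a)" if "a # xs \<in> S" for a xs
  proof (rule Suc.IH)
    show "finite (slice a)" by (rule fin)
    show "slice a \<noteq> {}" using that by (auto simp: slice_def)
    show "length ys = m" if "ys \<in> slice a" for ys
      using Suc.prems(3)[of "a # ys"] that by (simp add: slice_def)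
    show "\<exists>zs\<in>slice a. zs \<noteq> ys \<and> omit_nth j zs = omit_nth j ys"
      if "ys \<in> slice a" "j < m" for ys j
    proof -
      have "a # ys \<in> S" "Suc j < Suc m" using that by (simp_all add: slice_def)
      \<comment> \<open>Omitting position \<open>Suc j\<close> keeps the first component, so this
        neighbour again starts with \<open>a\<close> and its tail stays in the same slice.\<close>
      from Suc.prems(4)[OF this] obtain zs
        where zs: "zs \<in> S" "zs \<noteq> a # ys" "omit_nth (Suc j) zs = a # omit_nth j ys"
        unfolding omit_nth_Suc_Cons by blast
      from Suc.prems(3)[OF zs(1)] obtain b bs where "zs = b # bs"
        by (cases zs) auto
      with zs show ?thesis by (auto simp: slice_def)
    qed
  qed
  obtain xs where "xs \<in> S" using Suc.prems(2) by blast
  with Suc.prems(3) obtain a as where a: "a # as \<in> S"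
    by (metis length_Suc_conv)
  \<comment> \<open>A neighbour in direction 0 shares the tail \<open>as\<close>, so its first
    component \<open>b\<close> differs from \<open>a\<close>. Hence the slice at \<open>b\<close> is
    nonempty too, and the two prefixed slices are disjoint.\<close>
  obtain ys where ys: "ys \<in> S" "ys \<noteq> a # as" "omit_nth 0 ys = as"
    using Suc.prems(4)[OF a, of 0] by auto
  from Suc.prems(3)[OF ys(1)] obtain b where b: "ys = b # as"
    using ys(3) by (cases ys) auto
  have "2 ^ Suc m \<le> card (slice a) + card (slice b)"
    using slice_ge[OF a] slice_ge[of b as] ys(1) b by simp
  also have "\<dots> = card (Cons a ` slice a) + card (Cons b ` slice b)"
    by (simp add: card_image)
  also have "\<dots> = card (Cons a ` slice a \<union> Cons b ` slice b)"
    using ys(2) b fin by (intro card_Un_disjoint[symmetric]) auto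
  also have "\<dots> \<le> card S"
    using Suc.prems(1) by (intro card_mono) (auto simp: slice_def)
  finally show ?case .
qed

lemma (in private_key_scheme) known_plaintext_neighbour:
  assumes sec: "known_plaintext_secure m Msgs Keys \<Phi>"
    and M: "M \<in> Msgs" and C: "C \<in> \<Phi> M ` Keys" and j: "j < m"
  shows "\<exists>D\<in>\<Phi> M ` Keys. D \<noteq> C \<and> omit_nth j D = omit_nth j C"
proof (rule ccontr)
  let ?p = "msg_key Msgs Keys"
  let ?P = "\<lambda>\<omega>. \<Phi> (fst \<omega>) (snd \<omega>) = C"
  let ?Q = "\<lambda>\<omega>. fst \<omega> = M \<and> omit_nth j (\<Phi> (fst \<omega>) (snd \<omega>)) = omit_nth j C"
  assume no_neighbour: "\<not> ?thesis"
  have supp: "set_pmf ?p = Msgs \<times> Keys"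
    by (simp add: msg_key_def finite_Msgs Msgs_nonempty finite_Keys Keys_nonempty)
  obtain k where k: "k \<in> Keys" "C = \<Phi> M k" using C by blast
  \<comment> \<open>Positivity is essential: for a null event the conditional probability would be 0
    by convention and contradict nothing.\<close>
  have "measure_pmf.prob ?p {\<omega>. ?Q \<omega>} > 0"
    by (rule measure_pmf_posI[of "(M, k)"]) (use supp M k in auto)
  moreover have "measure_pmf.prob ?p {\<omega>. ?P \<omega> \<and> ?Q \<omega>} = measure_pmf.prob ?p {\<omega>. ?Q \<omega>}"
  proof (rule measure_prob_cong_0)
    \<comment> \<open>A support point here would be a pair of \<open>M\<close> and a key whose
      codeword differs from \<open>C\<close> only at position \<open>j\<close>, which
      \<open>no_neighbour\<close> excludes.\<close>
    fix \<omega> assume "\<omega> \<in> {\<omega>. ?Q \<omega>} - {\<omega>. ?P \<omega> \<and> ?Q \<omega>}"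
    then have "\<omega> \<notin> set_pmf ?p" unfolding supp using no_neighbour by auto
    then show "pmf ?p \<omega> = 0" by (simp add: set_pmf_iff)
  qed auto
  ultimately have "\<P>(\<omega> in measure_pmf ?p. ?P \<omega> \<bar> ?Q \<omega>) = 1"
    by (simp add: cond_prob_def)
  moreover have "length C = m"
    using length_Codes[OF enc_closed[OF M]] k by simp
  then have "\<P>(\<omega> in measure_pmf ?p. ?P \<omega> \<bar> ?Q \<omega>) \<le> 1 / 2"
    using sec M j by (simp add: known_plaintext_secure_def)
  ultimately show False by simp
qed

theorem lemma1:
  fixes m :: nat
    and Msgs :: "'a list set" and Keys :: "'k set" and Codes :: "'c list set"
    and \<Phi> :: "'a list \<Rightarrow> 'k \<Rightarrow> 'c list"
    and \<Psi> :: "'c list \<Rightarrow> 'k \<Rightarrow> 'a list"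
    and \<epsilon> :: real
  assumes "private_key_scheme m Msgs Keys Codes \<Phi> \<Psi>"
    and "eps_secure Msgs Keys Codes \<Psi> \<epsilon>"
    and "known_plaintext_secure m Msgs Keys \<Phi>"
  shows "card Keys \<ge> 2 ^ m"
proof -
  interpret private_key_scheme m Msgs Keys Codes \<Phi> \<Psi> by fact
  obtain M where M: "M \<in> Msgs" using Msgs_nonempty by blast
  have "2 ^ m \<le> card (\<Phi> M ` Keys)"
  proof (rule card_ge_power_if_neighbours)
    show "finite (\<Phi> M ` Keys)" "\<Phi> M ` Keys \<noteq> {}"
      using finite_Keys Keys_nonempty by auto
    show "length C = m" if "C \<in> \<Phi> M ` Keys" for C
      using that length_Codes enc_closed[OF M] by blast
  qed (rule known_plaintext_neighbour[OF assms(3) M])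
  \<comment> \<open>Distinct keys may send \<open>M\<close> to the same codeword, hence only an
    inequality.\<close>
  also have "\<dots> \<le> card Keys" by (rule card_image_le[OF finite_Keys])
  finally show ?thesis .
qed

end
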